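(* Let $\vec{x}=(x_1,\ldots,x_t)$ be a generalized Catalan list of nonzero integers with exactly two runs (i.e. $y=1$), let $\alpha_1$ be the maximum entry of its up-run and $\beta_1$ the maximum absolute value of an entry of its down-run. If ${\sf cost}(\vec{x})={\sf width}(\vec{x})$ and $\vec{x}$ is not reducible, then every entry of $\vec{x}$ equals either $\alpha_1$ or $-\beta_1$, and $\alpha_1$ and $\beta_1$ are relatively prime.
   Context: A list $\vec{x}=(x_1,\ldots,x_t)$ of nonzero integers is generalized Catalan if $\sum_{i=1}^t x_i=0$ and $\sum_{i=1}^q x_i\ge0$ for all $1\le q\le t$. A sublist is $(x_{i_1},\ldots,x_{i_a})$ with $i_1<\cdots<i_a$; its complementary sublist consists of the remaining entries in order. $\vec{x}$ is reducible if there is a generalized Catalan sublist whose complementary sublist is also generalized Catalan. A run is a maximal consecutive sublist of entries of the same sign (up-run: positive entries; down-run: negative entries); a generalized Catalan list has an even number $2y$ of runs. If $a_k>0$ is the maximum absolute value of an entry in the $k$-th run, ${\sf cost}(\vec{x})=\sum_{k=1}^{2y}a_k$ and ${\sf width}(\vec{x})=t$. *)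

theory Defs
  imports Main
begin

text \<open>
  Lists \<open>(x\<^sub>1, \<dots>, x\<^sub>t)\<close> are understood to be nonempty. For the notion of reducibility this
  matters: were the empty list admitted, every list would be reducible via the empty sublist.
\<close>
definition gen_catalan :: "int list \<Rightarrow> bool" where
  "gen_catalan xs \<longleftrightarrow>
     xs \<noteq> [] \<and> (\<forall>x\<in>set xs. x \<noteq> 0) \<and> sum_list xs = 0 \<and>
     (\<forall>q\<in>{1..length xs}. sum_list (take q xs) \<ge> 0)"

text \<open>
  \<open>I\<close> is the set of (0-based) positions of the sublist.
\<close>
definition reducible :: "int list \<Rightarrow> bool" where
  "reducible xs \<longleftrightarrow>
     (\<exists>I \<subseteq> {..<length xs}.
        gen_catalan (nths xs I) \<and> gen_catalan (nths xs ({..<length xs} - I)))"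

function runs :: "int list \<Rightarrow> int list list" where
  "runs [] = []"
| "runs (x # xs) =
     (x # takeWhile (\<lambda>y. sgn y = sgn x) xs) # runs (dropWhile (\<lambda>y. sgn y = sgn x) xs)"
  by pat_completeness auto
termination
  by (relation "measure length") (auto simp: less_Suc_eq_le length_dropWhile_le)

definition cost :: "int list \<Rightarrow> int" where
  "cost xs = (\<Sum>r\<leftarrow>runs xs. Max (abs ` set r))"

definition width :: "int list \<Rightarrow> nat" where
  "width xs = length xs"

text \<open>
  The next facts show that \<open>runs\<close> computes the decomposition into maximal consecutive
  blocks of constant sign.
\<close>
lemma concat_runs: "concat (runs xs) = xs"
  by (induction xs rule: runs.induct) auto

lemma runs_same_sign:
  "r \<in> set (runs xs) \<Longrightarrow> r \<noteq> [] \<and> (\<forall>x\<in>set r. \<forall>y\<in>set r. sgn x = sgn y)"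
proof (induction xs rule: runs.induct)
  case 1
  then show ?case by simp
next
  case (2 x xs)
  let ?P = "\<lambda>y. sgn y = sgn x"
  consider "r = x # takeWhile ?P xs" | "r \<in> set (runs (dropWhile ?P xs))"
    using "2.prems" unfolding runs.simps set_simps by blast
  then show ?case
  proof cases
    case 1
    have "sgn y = sgn x" if "y \<in> set r" for y
      using that set_takeWhileD[of y ?P xs] unfolding 1 set_simps by blast
    then show ?thesis using 1 by (metis list.discI)
  next
    case 2
    then show ?thesis by (rule "2.IH")
  qed
qed

lemma hd_runs: "xs \<noteq> [] \<Longrightarrow> runs xs \<noteq> [] \<and> hd (hd (runs xs)) = hd xs"
  by (cases xs) auto

lemma runs_maximal:
  "Suc k < length (runs xs) \<Longrightarrow> sgn (hd (runs xs ! k)) \<noteq> sgn (hd (runs xs ! Suc k))"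
proof (induction xs arbitrary: k rule: runs.induct)
  case 1
  then show ?case by simp
next
  case (2 x xs)
  let ?ys = "dropWhile (\<lambda>y. sgn y = sgn x) xs"
  show ?case
  proof (cases k)
    case 0
    have ne: "?ys \<noteq> []"
    proof
      assume "?ys = []"
      then have "length (runs (x # xs)) = 1" by (simp only: runs.simps list.size)
      with 0 "2.prems" show False by simp
    qed
    then have "sgn (hd ?ys) \<noteq> sgn x" using hd_dropWhile[OF ne] by blast
    moreover have "hd (runs ?ys ! 0) = hd ?ys" using hd_runs[OF ne] by (metis hd_conv_nth)
    ultimately show ?thesis using 0 by simp
  next
    case (Suc j)
    with 2 show ?thesis by simp
  qed
qed

text \<open>
  If a generalized Catalan list has exactly two runs, the first is the up-run and the second
  is the down-run.
\<close>
lemma gen_catalan_two_runs: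
  assumes "gen_catalan xs" and "runs xs = [us, ds]"
  shows "(\<forall>x\<in>set us. x > 0) \<and> (\<forall>x\<in>set ds. x < 0)"
proof -
  have xs: "xs = us @ ds" using concat_runs[of xs] assms(2) by simp
  have mem: "us \<in> set (runs xs)" "ds \<in> set (runs xs)" using assms(2) by simp_all
  have us: "us \<noteq> []" "\<forall>x\<in>set us. \<forall>y\<in>set us. sgn x = sgn y"
    and ds: "ds \<noteq> []" "\<forall>x\<in>set ds. \<forall>y\<in>set ds. sgn x = sgn y"
    using runs_same_sign[OF mem(1)] runs_same_sign[OF mem(2)] by blast+
  have ne: "sgn (hd us) \<noteq> sgn (hd ds)" using runs_maximal[of 0 xs] assms(2) by simp
  have nz: "\<forall>x\<in>set xs. x \<noteq> 0" and pre: "\<forall>q\<in>{1..length xs}. sum_list (take q xs) \<ge> 0"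
    and "xs \<noteq> []"
    using assms(1) by (auto simp: gen_catalan_def)
  have "sum_list (take 1 xs) \<ge> 0" using pre \<open>xs \<noteq> []\<close> by (simp add: Suc_le_eq)
  then have "hd us \<ge> 0" using us(1) xs by (cases us) auto
  moreover have "hd us \<noteq> 0" "hd ds \<noteq> 0" using nz us(1) ds(1) xs by auto
  ultimately have "sgn (hd us) = 1" "sgn (hd ds) = -1"
    using ne by (smt (verit) sgn_if)+
  then have "\<forall>x\<in>set us. sgn x = 1" "\<forall>x\<in>set ds. sgn x = -1"
    using us(2) ds(2) hd_in_set[OF us(1)] hd_in_set[OF ds(1)] by metis+
  then show ?thesis by (simp add: sgn_1_pos sgn_1_neg)
qed

end

theory Submission
  imports Defs "HOL-Library.Multiset"
begin

text \<open>
  Reorder the entries so that a positive entry is taken whenever the current partial sum is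
  nonpositive, and a negative one otherwise. The partial sums before the last entry then lie in
  \<open>{-\<beta><..\<alpha>}\<close>, and irreducibility makes them pairwise distinct. If there are \<open>\<alpha> + \<beta>\<close> entries,
  every value of that interval is therefore attained exactly once. The value \<open>\<alpha>\<close> can only be
  reached from \<open>0\<close>, that is by the first entry, which may be chosen to be any positive entry; so all
  positive entries equal \<open>\<alpha>\<close>, and by symmetry all negative ones equal \<open>-\<beta>\<close>. Finally, the value
  \<open>1\<close> is attained, so it is an integer combination of \<open>\<alpha>\<close> and \<open>\<beta>\<close>.
\<close>

text \<open>An order-free form of irreducibility: when positive entries precede negative ones, every
  nonempty zero-sum sublist is already generalized Catalan, so only the multiset of entries
  matters.\<close>

definition zero_sum_minimal :: "int multiset \<Rightarrow> bool" where
  "zero_sum_minimal M \<longleftrightarrow> sum_mset M = 0 \<and>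
     (\<forall>C. C \<subseteq># M \<longrightarrow> sum_mset C = 0 \<longrightarrow> C = {#} \<or> C = M)"

text \<open>The starting value \<open>s\<close> makes the tail of a walk a walk again, and allows a
  chosen first entry to be put in front.\<close>

definition greedy_walk :: "int \<Rightarrow> int list \<Rightarrow> bool" where
  "greedy_walk s zs \<longleftrightarrow>
     (\<forall>k<length zs. if s + sum_list (take k zs) \<le> 0 then zs ! k > 0 else zs ! k < 0)"

lemma greedy_walk_Cons:
  "greedy_walk s (z # zs) \<longleftrightarrow> (if s \<le> 0 then z > 0 else z < 0) \<and> greedy_walk (s + z) zs"
  unfolding greedy_walk_def length_Cons All_less_Suc2 by (simp add: add.assoc del: if_split)

section \<open>Existence and partial sums of greedy walks\<close>

lemma exists_pos_of_sum_mset_nonneg: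
  fixes M :: "int multiset"
  assumes "M \<noteq> {#}" "0 \<notin># M" "sum_mset M \<ge> 0"
  shows "\<exists>x\<in>#M. x > 0"
proof (rule ccontr)
  assume "\<not> ?thesis"
  then have neg: "\<forall>x\<in>#M. x < 0" using assms(2) by (metis linorder_neqE_linordered_idom)
  obtain x N where M: "M = add_mset x N" using assms(1) by (metis multiset_cases)
  have "sum_mset N \<le> 0" using neg unfolding M by (induction N) auto
  then show False using neg assms(3) unfolding M by simp
qed

lemma exists_neg_of_sum_mset_neg:
  fixes M :: "int multiset"
  assumes "sum_mset M < 0"
  shows "\<exists>x\<in>#M. x < 0"
proof (rule ccontr)
  assume "\<not> ?thesis"
  then have "sum_mset M \<ge> 0" by (induction M) (auto simp: not_less)
  then show False using assms by simp
qed

text \<open>The entries still to be placed sum to \<open>- s\<close>, so one of the required sign is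
  always among them; place it and continue from the shifted start.\<close>

lemma exists_greedy_walk:
  assumes "0 \<notin># M" "s + sum_mset M = 0"
  shows "\<exists>zs. mset zs = M \<and> greedy_walk s zs"
  using assms
proof (induction "size M" arbitrary: M s)
  case 0
  then show ?case by (simp add: greedy_walk_def)
next
  case (Suc n)
  have "M \<noteq> {#}" using Suc.hyps(2) by auto
  then have "\<exists>x\<in>#M. if s \<le> 0 then x > 0 else x < 0"
    using exists_pos_of_sum_mset_nonneg[of M] exists_neg_of_sum_mset_neg[of M] Suc.prems
    by (cases "s \<le> 0") simp_all
  then obtain x N where x: "if s \<le> 0 then x > 0 else x < 0" and M: "M = add_mset x N"
    by (metis mset_add)
  obtain zs where "mset zs = N" "greedy_walk (s + x) zs"
    using Suc.hyps(1)[of N "s + x"] Suc.hyps(2) Suc.prems unfolding M by (auto simp: add.assoc)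
  then show ?case using x unfolding M
    by (intro exI[of _ "x # zs"]) (simp add: greedy_walk_Cons)
qed

text \<open>Two equal partial sums would enclose a nonempty zero-sum block. It is proper because the
  full sum, at index \<open>length zs\<close>, is left out.\<close>

lemma inj_on_partial_sums:
  assumes "zero_sum_minimal (mset zs)"
  shows "inj_on (\<lambda>k. sum_list (take k zs)) {..<length zs}"
proof (rule linorder_inj_onI')
  fix i j assume ij: "i \<in> {..<length zs}" "j \<in> {..<length zs}" "i < j"
  let ?C = "mset (drop i (take j zs))"
  have tk: "take j zs = take i zs @ drop i (take j zs)"
    using append_take_drop_id[of i "take j zs"] ij by (simp add: min_def)
  have "zs = take i zs @ drop i (take j zs) @ drop j zs"
    using append_take_drop_id[of j zs] tk by (metis append.assoc)
  then have "mset zs = mset (take i zs) + (?C + mset (drop j zs))"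
    by (metis mset_append)
  then have "?C \<subseteq># mset zs"
    by (metis mset_subset_eq_add_left mset_subset_eq_add_right subset_mset.trans)
  moreover have "size ?C = j - i" "j - i \<noteq> 0" "j - i \<noteq> length zs" using ij by auto
  ultimately have "sum_mset ?C \<noteq> 0"
    using assms unfolding zero_sum_minimal_def by (metis size_empty size_mset)
  then show "sum_list (take i zs) \<noteq> sum_list (take j zs)"
    using arg_cong[OF tk, of sum_list] by (simp add: sum_mset_sum_list)
qed

text \<open>A rise starts at a value at most 0 and a fall at a positive one, so no step leaves the
  interval. It contains \<alpha> + \<beta> integers, as many as there are distinct partial
  sums.\<close>

lemma partial_sums_greedy_walk:
  assumes "zero_sum_minimal (mset zs)" "greedy_walk 0 zs"
    and bounds: "\<forall>z\<in>set zs. - \<beta> \<le> z \<and> z \<le> \<alpha>"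
    and "\<alpha> > 0" "\<beta> > 0" "int (length zs) = \<alpha> + \<beta>"
  shows "(\<lambda>k. sum_list (take k zs)) ` {..<length zs} = {- \<beta><..\<alpha>}"
proof (rule card_subset_eq)
  have "sum_list (take k zs) \<in> {- \<beta><..\<alpha>}" if "k < length zs" for k
    using that
  proof (induction k)
    case 0
    then show ?case using assms by simp
  next
    case (Suc k)
    have "- \<beta> \<le> zs ! k \<and> zs ! k \<le> \<alpha>" using bounds Suc.prems by simp
    moreover have "if sum_list (take k zs) \<le> 0 then zs ! k > 0 else zs ! k < 0"
      using assms(2) Suc.prems unfolding greedy_walk_def by simp
    ultimately show ?case using Suc by (auto simp: take_Suc_conv_app_nth split: if_splits)
  qed
  then show "(\<lambda>k. sum_list (take k zs)) ` {..<length zs} \<subseteq> {- \<beta><..\<alpha>}" by blast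
  show "card ((\<lambda>k. sum_list (take k zs)) ` {..<length zs}) = card {- \<beta><..\<alpha>}"
    using assms(6) by (simp add: card_image[OF inj_on_partial_sums[OF assms(1)]])
qed simp

section \<open>Rigidity of the entries\<close>

lemma pos_entry_eq_max:
  assumes min: "zero_sum_minimal M" and nz: "0 \<notin># M"
    and bounds: "\<forall>z\<in>#M. - \<beta> \<le> z \<and> z \<le> \<alpha>"
    and ab: "\<alpha> > 0" "\<beta> > 0" and sz: "int (size M) = \<alpha> + \<beta>"
    and u: "u \<in># M" "u > 0"
  shows "u = \<alpha>"
proof -
  obtain N where M: "M = add_mset u N" using u(1) by (metis mset_add)
  \<comment> \<open>The rest sums to \<open>- u\<close>, so it can be walked greedily from
    \<open>u\<close>; prepending \<open>u\<close> gives a walk from 0 with prescribed first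
    entry.\<close>
  obtain ys where ys: "mset ys = N" "greedy_walk u ys"
    using exists_greedy_walk[of N u] nz min unfolding M zero_sum_minimal_def by auto
  let ?zs = "u # ys" and ?S = "\<lambda>k. sum_list (take k (u # ys))"
  have zs: "mset ?zs = M" "greedy_walk 0 ?zs" using ys u(2) M by (auto simp: greedy_walk_Cons)
  have "length ?zs = size M" "set ?zs = set_mset M"
    using zs(1) by (metis size_mset, metis set_mset_mset)
  then have "?S ` {..<length ?zs} = {- \<beta><..\<alpha>}"
    using partial_sums_greedy_walk[of ?zs \<beta> \<alpha>] zs min bounds ab sz by simp
  moreover have "\<alpha> \<in> {- \<beta><..\<alpha>}" using ab by simp
  ultimately obtain k where k: "k < length ?zs" "?S k = \<alpha>"
    by (metis (no_types, lifting) imageE lessThan_iff)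
  then obtain j where j: "k = Suc j" using ab by (cases k) auto
  have step: "?S k = ?S j + ?zs ! j"
    using k(1) unfolding j by (subst take_Suc_conv_app_nth) auto
  have "?zs ! j \<le> \<alpha>"
    using bounds k(1) j \<open>set ?zs = set_mset M\<close> by (metis Suc_lessD nth_mem)
  moreover have "if ?S j \<le> 0 then ?zs ! j > 0 else ?zs ! j < 0"
    using zs(2) k(1) j unfolding greedy_walk_def by auto
  moreover have "?S j \<le> \<alpha>"
    using \<open>?S ` {..<length ?zs} = {- \<beta><..\<alpha>}\<close> k(1) j by fastforce
  \<comment> \<open>A fall would end strictly below \<alpha>, so the step is a rise of at most
    \<alpha> from a value at most 0. Reaching \<alpha> forces that value to be 0, which by
    injectivity occurs only at the start.\<close>
  ultimately have "?S j = 0" using step k(2) by (auto split: if_splits)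
  then have "?S j = ?S 0" by simp
  then have "j = 0"
    using inj_on_partial_sums[of ?zs] zs(1) min k(1) j
    by (metis (no_types, lifting) Suc_lessD inj_onD lessThan_iff zero_less_Suc less_trans)
  then show ?thesis using k(2) j by simp
qed

lemma zero_sum_minimal_uminus:
  assumes "zero_sum_minimal M"
  shows "zero_sum_minimal (image_mset uminus M)"
  unfolding zero_sum_minimal_def
proof (intro conjI allI impI)
  have sum: "sum_mset (image_mset uminus C) = - sum_mset C" for C :: "int multiset"
    by (induction C) auto
  have inv: "image_mset uminus (image_mset uminus C) = C" for C :: "int multiset"
    by (simp add: multiset.map_comp comp_def)
  show "sum_mset (image_mset uminus M) = 0"
    using assms by (simp add: sum zero_sum_minimal_def)
  fix C assume "C \<subseteq># image_mset uminus M" "sum_mset C = 0"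
  then have "image_mset uminus C \<subseteq># M" "sum_mset (image_mset uminus C) = 0"
    by (metis image_mset_subseteq_mono inv, simp add: sum)
  then have "image_mset uminus C = {#} \<or> image_mset uminus C = M"
    using assms unfolding zero_sum_minimal_def by blast
  then show "C = {#} \<or> C = image_mset uminus M" by (metis inv image_mset_is_empty_iff)
qed

text \<open>Negating all entries exchanges \<alpha> and \<beta> and reduces this to the positive
  case.\<close>

lemma neg_entry_eq_min:
  assumes "zero_sum_minimal M" "0 \<notin># M" "\<forall>z\<in>#M. - \<beta> \<le> z \<and> z \<le> \<alpha>"
    and "\<alpha> > 0" "\<beta> > 0" "int (size M) = \<alpha> + \<beta>" "d \<in># M" "d < 0"
  shows "d = - \<beta>"
proof -
  have "\<forall>z\<in>#image_mset uminus M. - \<alpha> \<le> z \<and> z \<le> \<beta>" using assms(3) by force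
  moreover have "0 \<notin># image_mset uminus M" using assms(2) by auto
  ultimately have "- d = \<beta>"
    using pos_entry_eq_max[OF zero_sum_minimal_uminus[OF assms(1)], of \<alpha> \<beta> "- d"] assms(4-8)
    by (simp add: add.commute)
  then show ?thesis by simp
qed

text \<open>Some partial sum equals 1, and a common divisor of \<alpha> and \<beta> divides every
  partial sum.\<close>

lemma coprime_of_two_valued:
  assumes min: "zero_sum_minimal M" and vals: "\<forall>z\<in>#M. z = \<alpha> \<or> z = - \<beta>"
    and ab: "\<alpha> > 0" "\<beta> > 0" and sz: "int (size M) = \<alpha> + \<beta>"
  shows "coprime \<alpha> \<beta>"
proof (rule coprimeI)
  fix c assume c: "c dvd \<alpha>" "c dvd \<beta>"
  have "0 \<notin># M" "sum_mset M = 0" using vals ab min by (auto simp: zero_sum_minimal_def)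
  then obtain zs where zs: "mset zs = M" "greedy_walk 0 zs"
    using exists_greedy_walk[of M 0] by auto
  have len: "length zs = size M" and set: "set zs = set_mset M"
    using zs(1) by (metis size_mset, metis set_mset_mset)
  have "\<forall>z\<in>set zs. - \<beta> \<le> z \<and> z \<le> \<alpha>" using vals ab set by force
  then have "(\<lambda>k. sum_list (take k zs)) ` {..<length zs} = {- \<beta><..\<alpha>}"
    using zs min ab sz len by (intro partial_sums_greedy_walk) simp_all
  moreover have "1 \<in> {- \<beta><..\<alpha>}" using ab by simp
  ultimately obtain k where k: "1 = sum_list (take k zs)" by (metis (no_types, lifting) imageE)
  have "\<forall>z\<in>set (take k zs). c dvd z"
    using vals c set by (metis dvd_minus_iff in_set_takeD)
  moreover have "c dvd sum_list ys" if "\<forall>z\<in>set ys. c dvd z" for ys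
    using that by (induction ys) auto
  ultimately have "c dvd sum_list (take k zs)" by blast
  then show "is_unit c" using k by simp
qed

section \<open>From submultisets back to sublists\<close>

lemma exists_nths_mset:
  assumes "C \<subseteq># mset xs"
  shows "\<exists>I \<subseteq> {..<length xs}. mset (nths xs I) = C \<and>
    mset (nths xs ({..<length xs} - I)) = mset xs - C"
  using assms
proof (induction xs arbitrary: C rule: rev_induct)
  case Nil
  then show ?case by auto
next
  case (snoc x xs)
  \<comment> \<open>Stated for arbitrary \<open>I\<close> because it is also applied to the
    complementary set of positions.\<close>
  have app: "nths (xs @ [x]) I = nths xs (I \<inter> {..<length xs}) @ (if length xs \<in> I then [x] else [])"
    for I
    by (auto simp: nths_append nths_singleton nths_def intro!: arg_cong[of _ _ "map fst"] filter_cong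
        dest: set_zip_rightD)
  show ?case
  \<comment> \<open>Earlier copies of \<open>x\<close> do no harm: if \<open>C\<close> contains
    \<open>x\<close>, one copy is assigned to the last position; otherwise \<open>C\<close> already
    fits into \<open>mset xs\<close>.\<close>
  proof (cases "x \<in># C")
    case True
    then obtain D where C: "C = add_mset x D" by (metis mset_add)
    with snoc obtain I where I: "I \<subseteq> {..<length xs}" "mset (nths xs I) = D"
      "mset (nths xs ({..<length xs} - I)) = mset xs - D" by auto
    have "insert (length xs) I \<inter> {..<length xs} = I"
      "({..<length (xs @ [x])} - insert (length xs) I) \<inter> {..<length xs} = {..<length xs} - I"
      using I(1) by auto
    moreover have "insert (length xs) I \<subseteq> {..<length (xs @ [x])}" using I(1) by auto
    ultimately show ?thesis using I C
      by (intro exI[of _ "insert (length xs) I"]) (simp add: app)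
  next
    case False
    then have "C \<subseteq># mset xs"
      using snoc.prems subset_eq_diff_conv[of C "{#x#}" "mset xs"] by (simp add: diff_single_trivial)
    with snoc.IH obtain I where I: "I \<subseteq> {..<length xs}" "mset (nths xs I) = C"
      "mset (nths xs ({..<length xs} - I)) = mset xs - C" by blast
    have "I \<inter> {..<length xs} = I"
      "({..<length (xs @ [x])} - I) \<inter> {..<length xs} = {..<length xs} - I" "length xs \<notin> I"
      using I(1) by auto
    moreover have "I \<subseteq> {..<length (xs @ [x])}" using I(1) by auto
    ultimately show ?thesis using I False
      by (intro exI[of _ I]) (simp add: app)
  qed
qed

text \<open>A prefix inside \<open>us\<close> has only positive entries; a longer one is the total 0
  minus a sum of negative entries.\<close>

lemma gen_catalan_append:
  assumes us: "\<forall>x\<in>set us. x > 0" and ds: "\<forall>x\<in>set ds. x < 0"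
    and sum: "sum_list (us @ ds) = 0" and ne: "us @ ds \<noteq> []"
  shows "gen_catalan (us @ ds)"
proof -
  have "sum_list (take q (us @ ds)) \<ge> 0" for q
  proof (cases "q \<le> length us")
    case True
    then show ?thesis using us by (auto intro!: sum_list_nonneg simp: order_less_imp_le dest!: in_set_takeD)
  next
    case False
    have "sum_list (drop q (us @ ds)) \<le> 0"
      using False ds by (auto intro!: sum_list_nonpos simp: order_less_imp_le dest!: in_set_dropD)
    moreover have "sum_list (take q (us @ ds)) + sum_list (drop q (us @ ds)) = 0"
      using sum by (metis append_take_drop_id sum_list_append)
    ultimately show ?thesis by linarith
  qed
  then show ?thesis using assms unfolding gen_catalan_def by fastforce
qed

text \<open>Sublists of \<open>us @ ds\<close> keep the shape of positives before negatives. Hence a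
  proper nonempty zero-sum submultiset and its complement would yield a reduction.\<close>

lemma zero_sum_minimal_of_not_reducible:
  assumes us: "\<forall>x\<in>set us. x > 0" and ds: "\<forall>x\<in>set ds. x < 0"
    and sum: "sum_list (us @ ds) = 0" and irr: "\<not> reducible (us @ ds)"
  shows "zero_sum_minimal (mset (us @ ds))"
  unfolding zero_sum_minimal_def
proof (intro conjI allI impI)
  let ?xs = "us @ ds"
  show total: "sum_mset (mset ?xs) = 0" using sum by (metis sum_mset_sum_list)
  have cat: "gen_catalan (nths ?xs J)" if "sum_mset (mset (nths ?xs J)) = 0" "nths ?xs J \<noteq> []" for J
    using that us ds unfolding nths_append sum_mset_sum_list
    by (intro gen_catalan_append) (auto dest: in_set_nthsD)
  fix C assume C: "C \<subseteq># mset ?xs" "sum_mset C = 0"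
  obtain I where I: "I \<subseteq> {..<length ?xs}" "mset (nths ?xs I) = C"
    "mset (nths ?xs ({..<length ?xs} - I)) = mset ?xs - C"
    using exists_nths_mset[OF C(1)] by blast
  have "C + (mset ?xs - C) = mset ?xs" using C(1) by simp
  then have "sum_mset (mset ?xs - C) = 0"
    using C(2) total by (metis add_0 sum_mset.union)
  show "C = {#} \<or> C = mset ?xs"
  proof (rule ccontr)
    assume "\<not> ?thesis"
    then have "C \<noteq> {#}" "mset ?xs - C \<noteq> {#}"
      using \<open>C + (mset ?xs - C) = mset ?xs\<close> by auto
    then have "nths ?xs I \<noteq> []" "nths ?xs ({..<length ?xs} - I) \<noteq> []"
      using I by (metis mset.simps(1))+
    then have "gen_catalan (nths ?xs I)" "gen_catalan (nths ?xs ({..<length ?xs} - I))"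
      using cat I C(2) \<open>sum_mset (mset ?xs - C) = 0\<close> by metis+
    then show False using irr I(1) unfolding reducible_def by blast
  qed
qed

theorem theorem3p2:
  fixes xs us ds :: "int list" and \<alpha> \<beta> :: int
  assumes "gen_catalan xs"
    and "runs xs = [us, ds]"
    and "\<alpha> = Max (set us)"
    and "\<beta> = Max (abs ` set ds)"
    and "cost xs = int (width xs)"
    and "\<not> reducible xs"
  shows "(\<forall>x\<in>set xs. x = \<alpha> \<or> x = - \<beta>) \<and> coprime \<alpha> \<beta>"
proof -
  have xs: "xs = us @ ds" using concat_runs[of xs] assms(2) by simp
  have ne: "us \<noteq> []" "ds \<noteq> []"
    using runs_same_sign[of us xs] runs_same_sign[of ds xs] assms(2) by auto
  have us: "\<forall>x\<in>set us. x > 0" and ds: "\<forall>x\<in>set ds. x < 0"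
    using gen_catalan_two_runs[OF assms(1,2)] by auto
  have min: "zero_sum_minimal (mset xs)"
    using zero_sum_minimal_of_not_reducible[OF us ds] assms(1,6)
    unfolding xs gen_catalan_def by blast
  have nz: "0 \<notin># mset xs" using us ds xs by auto
  have le_a: "x \<le> \<alpha>" if "x \<in> set us" for x using that assms(3) by simp
  have le_b: "- x \<le> \<beta>" if "x \<in> set ds" for x
  proof -
    have "\<bar>x\<bar> \<le> \<beta>" unfolding assms(4) using that by (intro Max_ge) auto
    then show ?thesis by linarith
  qed
  have ab: "\<alpha> > 0" "\<beta> > 0"
    using le_a[of "hd us"] le_b[of "hd ds"] us ds ne
    by (meson hd_in_set less_le_trans neg_0_less_iff_less)+
  have bounds: "\<forall>z\<in>#mset xs. - \<beta> \<le> z \<and> z \<le> \<alpha>"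
    using le_a le_b us ds ab unfolding xs by force
  \<comment> \<open>\<open>cost\<close> takes absolute values on both runs, while \<alpha> is a
    plain maximum; once these agree, the cost is \<alpha> + \<beta>.\<close>
  have "abs ` set us = set us" using us by force
  then have sz: "int (size (mset xs)) = \<alpha> + \<beta>"
    using assms(2-5) by (simp add: cost_def width_def)
  have vals: "\<forall>x\<in>#mset xs. x = \<alpha> \<or> x = - \<beta>"
    using pos_entry_eq_max[OF min nz bounds ab sz] neg_entry_eq_min[OF min nz bounds ab sz] nz
    by (metis linorder_neqE_linordered_idom)
  then show ?thesis using coprime_of_two_valued[OF min vals ab sz] by simp
qed

end
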